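(* Let $p$ and $q$ be weakly comaximal elements of $D$. If either $p\ge 0$ or $q\ge 0$ (as functions on $\mathbb{R}$), then the matrix $\begin{pmatrix} p & q\\ 0 & 0\end{pmatrix}\in M_2(D)$ is a product of idempotent matrices over $D$.
   Context: $D$ denotes the minimal Dress ring of $\mathbb{R}(X)$, i.e. the subring of $\mathbb{R}(X)$ generated by all elements $1/(1+x^2)$ with $x\in\mathbb{R}(X)$. Let $\Gamma$ be the set of polynomials in $\mathbb{R}[X]$ having no roots in $\mathbb{R}$ (including nonzero constants), and $\Gamma^+=\{f\in\mathbb{R}[X] : f(r)>0 \ \forall r\in\mathbb{R}\}$. It is known that $D=\{f/\gamma : f\in\mathbb{R}[X],\ \gamma\in\Gamma,\ \deg f\le\deg\gamma\}$. Elements of $D$ are thus viewed as functions on $\mathbb{R}$ without poles; $p\ge 0$ means $p(r)\ge 0$ for all $r\in\mathbb{R}$. Two polynomials $x,y\in\mathbb{R}[X]$ are weakly comaximal if $\gcd(x,y)\in\Gamma$, i.e. if they have no common real roots. Two elements $p,q\in D$, written as $p=x/\gamma$, $q=y/\gamma$ with $\gamma\in\Gamma^+$ and $x,y\in\mathbb{R}[X]$, are weakly comaximal if $x$ and $y$ are. A matrix $\mathbf{T}$ is idempotent if $\mathbf{T}^2=\mathbf{T}$. *)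

theory Defs
  imports
    "HOL-Analysis.Analysis"
    "HOL-Computational_Algebra.Computational_Algebra"
    "HOL-Computational_Algebra.Field_as_Ring"
begin

type_synonym ratfun = "real poly fract"

inductive_set dress :: "ratfun set" where
  gen: "1 / (1 + x ^ 2) \<in> dress"
| one: "1 \<in> dress"
| diff: "a \<in> dress \<Longrightarrow> b \<in> dress \<Longrightarrow> a - b \<in> dress"
| mult: "a \<in> dress \<Longrightarrow> b \<in> dress \<Longrightarrow> a * b \<in> dress"

definition Gam :: "real poly set" where
  "Gam = {f. \<forall>r. poly f r \<noteq> 0}"

definition Gam_pos :: "real poly set" where
  "Gam_pos = {f. \<forall>r. poly f r > 0}"

text \<open>
  The value of a rational function at a real point, computed from its reduced fraction.
  At a pole the result is the junk value 0; elements of \<^term>\<open>dress\<close> have no real poles.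
\<close>
definition rat_eval :: "ratfun \<Rightarrow> real \<Rightarrow> real" where
  "rat_eval p r = poly (fst (quot_of_fract p)) r / poly (snd (quot_of_fract p)) r"

lemma rat_eval_Fract:
  assumes "poly g r \<noteq> 0"
  shows "rat_eval (Fract f g) r = poly f r / poly g r"
proof -
  define a b where "a = fst (quot_of_fract (Fract f g))" and "b = snd (quot_of_fract (Fract f g))"
  have g0: "g \<noteq> 0" using assms by auto
  have b0: "b \<noteq> 0" by (simp add: b_def)
  have "Fract a b = Fract f g" by (simp add: a_def b_def)
  then have e: "a * g = f * b" using g0 b0 by (simp add: eq_fract)
  have cop: "coprime a b" by (simp add: a_def b_def coprime_quot_of_fract)
  have "b dvd a * g" using e by simp
  then have "b dvd g" using cop by (simp add: coprime_commute coprime_dvd_mult_right_iff)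
  then have "poly b r \<noteq> 0" using assms by (auto elim!: dvdE)
  moreover have "poly a r * poly g r = poly f r * poly b r"
    using arg_cong[OF e, of "\<lambda>h. poly h r"] by simp
  ultimately show ?thesis
    using assms by (simp add: rat_eval_def a_def b_def field_simps)
qed

definition dress_nonneg :: "ratfun \<Rightarrow> bool" where
  "dress_nonneg p \<longleftrightarrow> (\<forall>r. rat_eval p r \<ge> 0)"

definition weakly_comaximal_poly :: "real poly \<Rightarrow> real poly \<Rightarrow> bool" where
  "weakly_comaximal_poly x y \<longleftrightarrow> gcd x y \<in> Gam"

lemma weakly_comaximal_poly_iff:
  "weakly_comaximal_poly x y \<longleftrightarrow> \<not> (\<exists>r. poly x r = 0 \<and> poly y r = 0)"
proof -
  have "poly (gcd x y) r = 0 \<longleftrightarrow> poly x r = 0 \<and> poly y r = 0" for r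
    by (simp add: poly_eq_0_iff_dvd)
  then show ?thesis by (simp add: weakly_comaximal_poly_def Gam_def)
qed

definition weakly_comaximal :: "ratfun \<Rightarrow> ratfun \<Rightarrow> bool" where
  "weakly_comaximal p q \<longleftrightarrow>
     (\<exists>x y \<gamma>. \<gamma> \<in> Gam_pos \<and> p = Fract x \<gamma> \<and> q = Fract y \<gamma> \<and> weakly_comaximal_poly x y)"

text \<open>The choice of the common denominator is immaterial.\<close>
lemma weakly_comaximal_Fract:
  assumes "\<gamma> \<in> Gam_pos"
  shows "weakly_comaximal (Fract x \<gamma>) (Fract y \<gamma>) \<longleftrightarrow> weakly_comaximal_poly x y"
proof
  assume "weakly_comaximal (Fract x \<gamma>) (Fract y \<gamma>)"
  then obtain x' y' d where d: "d \<in> Gam_pos" "Fract x \<gamma> = Fract x' d" "Fract y \<gamma> = Fract y' d"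
    "weakly_comaximal_poly x' y'"
    by (auto simp: weakly_comaximal_def)
  have nz: "poly \<gamma> r \<noteq> 0" "poly d r \<noteq> 0" for r
    using assms d(1) by (auto simp: Gam_pos_def less_le)
  have "poly x r / poly \<gamma> r = poly x' r / poly d r" "poly y r / poly \<gamma> r = poly y' r / poly d r" for r
    using d(2,3) nz by (metis rat_eval_Fract)+
  then have "poly x r = 0 \<longleftrightarrow> poly x' r = 0" "poly y r = 0 \<longleftrightarrow> poly y' r = 0" for r
    using nz by (metis divide_eq_0_iff)+
  with d(4) show "weakly_comaximal_poly x y"
    by (simp add: weakly_comaximal_poly_iff)
next
  assume "weakly_comaximal_poly x y"
  with assms show "weakly_comaximal (Fract x \<gamma>) (Fract y \<gamma>)"
    by (auto simp: weakly_comaximal_def)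
qed

definition dress_matrices :: "(ratfun ^ 2 ^ 2) set" where
  "dress_matrices = {A. \<forall>i j. A $ i $ j \<in> dress}"

definition idempotent_matrix :: "ratfun ^ 2 ^ 2 \<Rightarrow> bool" where
  "idempotent_matrix T \<longleftrightarrow> T ** T = T"

definition product_of_idempotents :: "ratfun ^ 2 ^ 2 \<Rightarrow> bool" where
  "product_of_idempotents A \<longleftrightarrow>
     (\<exists>Ts. Ts \<noteq> [] \<and> (\<forall>T \<in> set Ts. T \<in> dress_matrices \<and> idempotent_matrix T) \<and>
           A = foldr (**) Ts (mat 1))"

end

theory Submission
  imports Defs
begin

text \<open>
  The elements of the Dress ring are the rational functions \<open>f / g\<close> with \<open>g\<close> free of real zeros and
  \<open>degree f \<le> degree g\<close> (\<open>Fract_in_dress_iff\<close>): the rational functions without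
  poles on the circle formed by the real line and the point at infinity. Its units are the functions
  without zeros on that circle. The hard inclusion \<open>W_power_over_Gam\<close> comes from factoring \<open>g\<close> into
  real quadratics, for which \<open>(1 + X\<^sup>2) / ((X - a)\<^sup>2 + b\<^sup>2)\<close> is a combination of \<open>1\<close>,
  \<open>x / (1 + x\<^sup>2)\<close> and \<open>1 / (1 + x\<^sup>2)\<close> with \<open>x = (X - a) / b\<close>.

  Consider the rows \<open>(a, b)\<close> whose completion by a zero row is a product of idempotents. They are
  closed under multiplication by scalars from the ring. Conjugating the completed matrix, and
  multiplying it by further idempotents from the left, shows that they are also closed under
  elementary column operations, the swap of the two entries and multiplication of one entry by a
  unit. So a row containing a unit is always good.

  Let \<open>p \<ge> 0\<close>. Up to a scalar in the ring, weakly comaximal \<open>p\<close> and \<open>q\<close> may be assumed to have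
  minimal order of vanishing \<open>0\<close> or \<open>1\<close> at infinity, since \<open>1 + X\<^sup>2\<close> has even degree.
  As \<open>p \<ge> 0\<close>, the function \<open>p + q\<^sup>2\<close> has no real zero, and it is reached from \<open>p\<close> by a column
  operation. In the case of order \<open>0\<close> it does not vanish at infinity either, so it is a unit.
  In the case of order \<open>1\<close> the order of \<open>p\<close> is even or infinite, hence at least \<open>2\<close>, while that of \<open>q\<close> is
  \<open>1\<close>; so \<open>p + q\<^sup>2\<close> is a unit times \<open>1 / (1 + X\<^sup>2)\<close>, and modulo this element \<open>q\<close> is
  a constant times \<open>X / (1 + X\<^sup>2)\<close>. What remains is the row \<open>(1, X) / (1 + X\<^sup>2)\<close>, the first
  row of the orthogonal projection onto the line spanned by \<open>(1, X)\<close> (\<open>idempotent_row_circle\<close>).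
\<close>

section \<open>Real polynomials without sign changes\<close>

lemma lead_coeff_nonneg:
  fixes f :: "real poly"
  assumes "\<And>r. poly f r \<ge> 0"
  shows "lead_coeff f \<ge> 0"
proof (rule ccontr)
  assume "\<not> lead_coeff f \<ge> 0"
  then have neg: "lead_coeff (- f) > 0" by simp
  then obtain n where "\<forall>x\<ge>n. poly (- f) x \<ge> lead_coeff (- f)"
    using poly_pinfty_gt_lc by blast
  then have "poly (- f) n > 0" using neg by fastforce
  with assms[of n] show False by simp
qed

text \<open>
  The leading coefficients of \<open>f(X)\<close> and \<open>f(-X)\<close> are both nonnegative, and they differ by the factor
  \<open>(-1) ^ degree f\<close>.
\<close>
lemma even_degree_nonneg:
  fixes f :: "real poly"
  assumes "\<And>r. poly f r \<ge> 0"
  shows "even (degree f)"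
proof (cases "f = 0")
  case False
  have "lead_coeff f > 0"
    using lead_coeff_nonneg[OF assms] False by (simp add: less_le)
  moreover have "lead_coeff (f \<circ>\<^sub>p [:0, -1:]) \<ge> 0"
    by (rule lead_coeff_nonneg) (simp add: poly_pcompose assms)
  then have "lead_coeff f * (-1) ^ degree f \<ge> 0"
    by (simp add: lead_coeff_comp)
  ultimately show ?thesis
    by (cases "even (degree f)") auto
qed simp

text \<open>
  Leading terms of nonnegative polynomials have nonnegative coefficients and so cannot cancel.
\<close>
lemma degree_add_nonneg:
  fixes f g :: "real poly"
  assumes f: "\<And>r. poly f r \<ge> 0" and g: "\<And>r. poly g r \<ge> 0"
  shows "degree (f + g) = max (degree f) (degree g)"
proof (rule antisym)
  show "degree (f + g) \<le> max (degree f) (degree g)"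
    by (rule degree_add_le_max)
  have nonneg: "lead_coeff f \<ge> 0" "lead_coeff g \<ge> 0"
    using f g by (simp_all add: lead_coeff_nonneg)
  consider "degree f < degree g" | "degree g < degree f" | "degree f = degree g"
    by linarith
  then show "max (degree f) (degree g) \<le> degree (f + g)"
  proof cases
    case 1
    then show ?thesis using degree_add_eq_right[OF 1] by linarith
  next
    case 2
    then show ?thesis using degree_add_eq_left[OF 2] by linarith
  next
    case 3
    show ?thesis
    proof (cases "f = 0")
      case True
      then show ?thesis by simp
    next
      case False
      then have "lead_coeff f \<noteq> 0" by simp
      then have "lead_coeff f > 0" using nonneg(1) by linarith
      moreover have "coeff g (degree f) \<ge> 0" unfolding 3 by (rule nonneg(2))
      ultimately have "coeff (f + g) (degree f) \<noteq> 0" unfolding coeff_add by linarith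
      then have "degree f \<le> degree (f + g)" by (rule le_degree)
      then show ?thesis unfolding 3 max.idem .
    qed
  qed
qed

lemma Gam_pos_subset_Gam: "Gam_pos \<subseteq> Gam"
  by (auto simp: Gam_def Gam_pos_def less_le)

lemma Gam_nonzero: "g \<in> Gam \<Longrightarrow> g \<noteq> 0"
  by (auto simp: Gam_def)

lemma map_poly_of_real_add:
  "map_poly complex_of_real (p + q) = map_poly of_real p + map_poly of_real q"
  by (rule poly_eqI) (simp add: coeff_map_poly)

lemma poly_of_real_mult:
  fixes p q :: "real poly" and z :: complex
  shows "poly (map_poly of_real (p * q)) z =
    poly (map_poly of_real p) z * poly (map_poly of_real q) z"
  by (induction p)
     (simp_all add: map_poly_of_real_add map_poly_smult map_poly_pCons algebra_simps)

lemma poly_of_real_of_real: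
  "poly (map_poly of_real p) (of_real x :: complex) = of_real (poly p x)"
  by (induction p) (simp_all add: map_poly_pCons)

text \<open>
  The quadratic is \<open>(X - z) (X - cnj z)\<close> for a complex root \<open>z = a + b \<i>\<close>. It divides \<open>g\<close> over the
  reals because the remainder is a real polynomial of degree at most \<open>1\<close> with the nonreal root \<open>z\<close>.
\<close>
lemma Gam_quadratic_factor:
  assumes g: "g \<in> Gam" and deg: "degree g > 0"
  obtains a b :: real and h
  where "b \<noteq> 0" "h \<in> Gam" "g = [:a\<^sup>2 + b\<^sup>2, - (2 * a), 1:] * h" "degree g = degree h + 2"
proof -
  have "degree (map_poly complex_of_real g) > 0"
    using deg by (simp add: degree_map_poly)
  then obtain z where z: "poly (map_poly complex_of_real g) z = 0"
    using alg_closed_imp_poly_has_root by blast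
  define a b where "a = Re z" and "b = Im z"
  have b: "b \<noteq> 0"
  proof
    assume "b = 0"
    then have "z = of_real a" by (simp add: a_def b_def complex_eq_iff)
    then have "complex_of_real (poly g a) = 0"
      using z by (simp add: poly_of_real_of_real)
    then show False using g by (simp add: Gam_def)
  qed
  define Q where "Q = [:a\<^sup>2 + b\<^sup>2, - (2 * a), 1:]"
  define s where "s = g mod Q"
  have Q0: "Q \<noteq> 0" and degQ: "degree Q = 2" by (simp_all add: Q_def)
  have "z * z + of_real (a\<^sup>2 + b\<^sup>2) - 2 * of_real a * z = 0"
    by (simp add: a_def b_def complex_eq_iff power2_eq_square algebra_simps)
  then have Qz: "poly (map_poly complex_of_real Q) z = 0"
    by (simp add: Q_def map_poly_pCons algebra_simps)
  have "degree s < 2" using degree_mod_less[OF Q0, of g] degQ by (auto simp: s_def)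
  then have "coeff s n = coeff [:coeff s 0, coeff s 1:] n" for n
    by (auto simp: coeff_pCons coeff_eq_0 split: nat.splits)
  then obtain c d where s: "s = [:c, d:]" using poly_eqI by blast
  have "g = Q * (g div Q) + s" by (simp add: s_def)
  from arg_cong[OF this, of "\<lambda>f. poly (map_poly complex_of_real f) z"]
  have "poly (map_poly complex_of_real s) z = 0"
    using z Qz by (simp only: map_poly_of_real_add poly_add poly_of_real_mult) simp
  then have "of_real c + z * of_real d = 0"
    by (simp add: s map_poly_pCons)
  then have "d = 0" "c = 0"
    using b by (auto simp: complex_eq_iff a_def b_def)
  then have gQ: "g = Q * (g div Q)" using \<open>g = Q * (g div Q) + s\<close> s by simp
  have "g div Q \<in> Gam"
  proof -
    have "poly g r = poly Q r * poly (g div Q) r" for r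
      using arg_cong[OF gQ, of "\<lambda>f. poly f r"] by (simp only: poly_mult)
    then show ?thesis using g by (simp add: Gam_def)
  qed
  moreover have "degree g = degree (g div Q) + 2"
    using arg_cong[OF gQ, of degree] degQ
      degree_mult_eq[OF Q0 Gam_nonzero[OF \<open>g div Q \<in> Gam\<close>]] by linarith
  ultimately show thesis using that b gQ unfolding Q_def by blast
qed


section \<open>The Dress ring\<close>

lemma dress_zero: "0 \<in> dress"
  using dress.diff[OF dress.one dress.one] by simp

lemma dress_uminus: "a \<in> dress \<Longrightarrow> - a \<in> dress"
  using dress.diff[OF dress_zero] by simp

lemma dress_add: "a \<in> dress \<Longrightarrow> b \<in> dress \<Longrightarrow> a + b \<in> dress"
  using dress.diff[OF _ dress_uminus] by fastforce

text \<open>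
  Constants \<open>t\<close> in \<open>(0, 1]\<close> have the form \<open>1 / (1 + s\<^sup>2)\<close> with \<open>s\<close> real; multiplying by natural
  numbers and subtracting yields the other reals.
\<close>
lemma dress_const: "to_fract [:c:] \<in> dress"
proof -
  have unit_interval: "to_fract [:t:] \<in> dress" if t: "0 < t" "t \<le> 1" for t :: real
  proof -
    define s where "s = sqrt (1 / t - 1)"
    have s: "t * (1 + s * s) = 1"
      using t by (simp add: s_def field_simps)
    have "to_fract [:t:] * (1 + to_fract [:s:] ^ 2) = to_fract ([:t:] * (1 + [:s:] * [:s:]))"
      by (simp add: power2_eq_square del: mult_pCons_left mult_pCons_right)
    also have "[:t:] * (1 + [:s:] * [:s:]) = 1"
      using s by (simp add: one_pCons mult.commute)
    finally have "to_fract [:t:] = 1 / (1 + to_fract [:s:] ^ 2)"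
      by (metis mult_zero_right nonzero_eq_divide_eq to_fract_1 zero_neq_one)
    then show ?thesis using dress.gen[of "to_fract [:s:]"] by simp
  qed
  have nat: "to_fract [:of_nat n:] \<in> dress" for n
  proof (induction n)
    case (Suc n)
    have "to_fract [:of_nat (Suc n):] = 1 + to_fract [:of_nat n :: real:]"
      by (simp add: one_pCons flip: to_fract_1 to_fract_add)
    then show ?case using dress_add[OF dress.one Suc] by simp
  qed (simp add: dress_zero)
  have pos: "to_fract [:t:] \<in> dress" if "t > 0" for t :: real
  proof -
    obtain n :: nat where "t < n" using reals_Archimedean2 by blast
    then have n: "n > 0" "t \<le> n" using that by (auto intro: gr0I)
    have "to_fract [:t:] = to_fract [:of_nat n:] * to_fract [:t / n:]"
      using n by (simp flip: to_fract_mult)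
    then show ?thesis using dress.mult[OF nat unit_interval[of "t / n"]] n that by simp
  qed
  have "to_fract [:c:] = to_fract [:\<bar>c\<bar> + 1:] - to_fract [:\<bar>c\<bar> + 1 - c:]"
    by (simp flip: to_fract_diff)
  then show ?thesis using dress.diff[OF pos[of "\<bar>c\<bar> + 1"] pos[of "\<bar>c\<bar> + 1 - c"]] by simp
qed

lemma one_plus_square_nonzero: "1 + x ^ 2 \<noteq> (0 :: ratfun)"
  using add_pos_nonneg[OF zero_less_one zero_le_power2[of x]] by simp

text \<open>
  With the Cayley transform \<open>y = (x - 1) / (x + 1)\<close> the generator \<open>1 / (1 + y\<^sup>2)\<close> equals
  \<open>1 / 2 + x / (1 + x\<^sup>2)\<close>; on the unit circle parametrised by \<open>x\<close> this is the rotation by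
  a quarter turn, which carries the cosine to the sine.
\<close>
lemma dress_x_over_one_plus_square: "x / (1 + x ^ 2) \<in> dress"
proof (cases "x = - 1")
  case True
  then have "x / (1 + x ^ 2) = - (1 / (1 + x ^ 2))" by simp
  then show ?thesis using dress_uminus[OF dress.gen] by metis
next
  case False
  define y where "y = (x - 1) / (x + 1)"
  have x1: "x + 1 \<noteq> 0" using False by (simp add: eq_neg_iff_add_eq_0)
  have y: "1 + y ^ 2 = 2 * (1 + x ^ 2) / (x + 1) ^ 2"
  proof -
    have "1 + y ^ 2 = ((x + 1) ^ 2 + (x - 1) ^ 2) / (x + 1) ^ 2"
      using x1 by (simp add: y_def power_divide add_divide_distrib)
    also have "(x + 1) ^ 2 + (x - 1) ^ 2 = 2 * (1 + x ^ 2)"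
      by (simp add: power2_eq_square algebra_simps)
    finally show ?thesis .
  qed
  have "1 / (1 + y ^ 2) - 1 / 2 = ((x + 1) ^ 2 - (1 + x ^ 2)) / (2 * (1 + x ^ 2))"
    unfolding y using one_plus_square_nonzero[of x] by (simp add: diff_divide_distrib)
  also have "(x + 1) ^ 2 - (1 + x ^ 2) = 2 * x"
    unfolding power2_sum by simp
  finally have "x / (1 + x ^ 2) = 1 / (1 + y ^ 2) - 1 / (1 + 1 ^ 2)"
    by (simp only: mult_divide_mult_cancel_left_if) simp
  then show ?thesis by (simp only: dress.diff dress.gen)
qed

text \<open>
  The powers of \<open>W = 1 + X\<^sup>2\<close> are the standard denominators: \<open>1 / W\<close> has no real zero and
  vanishes to order \<open>2\<close> at infinity.
\<close>
definition W :: "real poly" where "W = [:1, 0, 1:]"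

lemma poly_W: "poly W r = 1 + r\<^sup>2"
  by (simp add: W_def power2_eq_square)

lemma W_pos: "poly W r > 0"
  unfolding poly_W by (rule add_pos_nonneg) simp_all

lemma W_nonzero [simp]: "W \<noteq> 0"
  by (simp add: W_def)

lemma W_power_Gam: "W ^ n \<in> Gam"
  unfolding Gam_def using W_pos by (simp add: less_imp_neq[THEN not_sym])

lemma degree_W: "degree W = 2"
  by (simp add: W_def)

lemma lead_coeff_W: "lead_coeff W = 1"
  by (simp add: W_def)

lemma degree_W_power: "degree (W ^ n) = 2 * n"
  by (simp add: degree_power_eq degree_W)

lemma to_fract_power [simp]: "to_fract (f ^ n) = to_fract f ^ n"
  by (induction n) simp_all

lemma to_fract_W: "to_fract W = 1 + to_fract [:0, 1:] ^ 2"
proof -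
  have "W = 1 + [:0, 1:] * [:0, 1:]" by (simp add: W_def one_pCons)
  from arg_cong[OF this, of to_fract] show ?thesis
    by (simp only: to_fract_add to_fract_mult to_fract_1 power2_eq_square)
qed

text \<open>
  By linearity the numerator may be a monomial \<open>X ^ i\<close> with \<open>i \<le> 2 * n\<close>, and then the fraction is a
  product of \<open>n\<close> factors among \<open>1 / W\<close>, \<open>X / W\<close> and \<open>X\<^sup>2 / W\<close>.
\<close>
lemma dress_over_W_power:
  assumes "degree f \<le> 2 * n"
  shows "Fract f (W ^ n) \<in> dress"
proof -
  define X where "X = to_fract [:0, 1 :: real:]"
  have W: "to_fract W = 1 + X ^ 2" unfolding X_def by (rule to_fract_W)
  have W0: "1 + X ^ 2 \<noteq> 0" by (rule one_plus_square_nonzero)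
  have low: "1 / (1 + X ^ 2) \<in> dress" "X / (1 + X ^ 2) \<in> dress" "X ^ 2 / (1 + X ^ 2) \<in> dress"
  proof -
    have "X ^ 2 / (1 + X ^ 2) = 1 - 1 / (1 + X ^ 2)" using W0 by (simp add: field_simps)
    then show "X ^ 2 / (1 + X ^ 2) \<in> dress" using dress.diff[OF dress.one dress.gen] by metis
  qed (rule dress.gen dress_x_over_one_plus_square)+
  have mon: "i \<le> 2 * n \<Longrightarrow> X ^ i / (1 + X ^ 2) ^ n \<in> dress" for i n
  proof (induction n arbitrary: i)
    case (Suc n)
    obtain j k where jk: "i = j + k" "j \<le> 2" "k \<le> 2 * n"
    proof (cases "i \<le> 2")
      case True then show ?thesis using that[of i 0] by simp
    next
      case False then show ?thesis using that[of 2 "i - 2"] Suc.prems by simp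
    qed
    have "X ^ j / (1 + X ^ 2) \<in> dress"
      using jk(2) low by (auto simp: le_Suc_eq numeral_2_eq_2)
    then have "X ^ j / (1 + X ^ 2) * (X ^ k / (1 + X ^ 2) ^ n) \<in> dress"
      using Suc.IH[OF jk(3)] by (rule dress.mult)
    then show ?case using W0 by (simp add: jk(1) power_add field_simps)
  qed (simp add: dress.one)
  have Xpow: "to_fract (monom 1 i) = X ^ i" for i
  proof (induction i)
    case (Suc i)
    have "monom 1 (Suc i) = [:0, 1:] * (monom 1 i :: real poly)" by (simp add: monom_Suc)
    then show ?case using Suc by (simp only: to_fract_mult X_def power_Suc)
  qed (simp add: monom_0 flip: one_pCons)
  have "to_fract f = (\<Sum>i\<le>degree f. to_fract [:coeff f i:] * X ^ i)"
    by (subst poly_as_sum_of_monoms[symmetric])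
       (simp add: Xpow[symmetric] smult_monom flip: to_fract_mult)
  then have "Fract f (W ^ n) = (\<Sum>i\<le>degree f. to_fract [:coeff f i:] * (X ^ i / (1 + X ^ 2) ^ n))"
    by (simp add: Fract_conv_to_fract W sum_divide_distrib)
  moreover have "\<dots> \<in> dress"
  proof -
    have "(\<Sum>i\<in>A. to_fract [:coeff f i:] * (X ^ i / (1 + X ^ 2) ^ n)) \<in> dress"
      if "finite A" "\<forall>i\<in>A. i \<le> 2 * n" for A
      using that
      by (induction A rule: finite_induct)
         (auto intro!: dress_zero dress_add dress.mult dress_const mon
           simp del: times_divide_eq_right)
    then show ?thesis using assms by (meson atMost_iff finite_atMost order_trans)
  qed
  ultimately show ?thesis by (rule ssubst)
qed

text \<open>
  This says that the element \<open>g / W ^ n\<close>, which has no zeros on the circle, is invertible in the ring.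
  The quadratic factors of \<open>g\<close> are inverted one at a time.
\<close>
lemma W_power_over_Gam:
  assumes "g \<in> Gam"
  shows "\<exists>n. degree g = 2 * n \<and> Fract (W ^ n) g \<in> dress"
  using assms
proof (induction "degree g" arbitrary: g rule: less_induct)
  case less
  show ?case
  proof (cases "degree g = 0")
    case True
    then obtain c where c: "g = [:c:]" by (rule degree_eq_zeroE)
    have "c \<noteq> 0" using less.prems by (simp add: c Gam_def)
    then have "Fract 1 g = to_fract [:1 / c:]"
      by (simp add: c to_fract_def eq_fract one_pCons)
    then show ?thesis using True dress_const by auto
  next
    case False
    obtain a b h where b: "b \<noteq> 0" and h: "h \<in> Gam"
      and gh: "g = [:a\<^sup>2 + b\<^sup>2, - (2 * a), 1:] * h" and deg: "degree g = degree h + 2"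
      using Gam_quadratic_factor[OF less.prems] False by blast
    obtain n where n: "degree h = 2 * n" "Fract (W ^ n) h \<in> dress"
      using less.hyps[of h] deg h by auto
    define x where "x = Fract [:- a, 1:] [:b:]"
    define Q where "Q = [:a\<^sup>2 + b\<^sup>2, - (2 * a), 1:]"
    have Q0: "to_fract Q \<noteq> 0" by (simp add: Q_def)
    have B0: "to_fract [:b:] \<noteq> 0" using b by simp
    have "[:b:] * [:b:] + [:- a, 1:] * [:- a, 1:] = Q"
      by (simp add: Q_def power2_eq_square)
    then have sq: "to_fract [:b:] ^ 2 + to_fract [:- a, 1:] ^ 2 = to_fract Q"
      by (simp add: power2_eq_square flip: to_fract_mult to_fract_add)
    have x2: "1 + x ^ 2 = to_fract Q / to_fract [:b:] ^ 2"
      using B0 by (simp add: x_def Fract_conv_to_fract field_simps flip: sq)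
    have r1: "1 / (1 + x ^ 2) = Fract ([:b:] * [:b:]) Q"
      unfolding x2 Fract_conv_to_fract to_fract_mult by (simp add: power2_eq_square)
    have r2: "x / (1 + x ^ 2) = Fract ([:b:] * [:- a, 1:]) Q"
      unfolding x2 Fract_conv_to_fract to_fract_mult
      using B0 by (simp add: x_def Fract_conv_to_fract power2_eq_square)
    define \<alpha> \<beta> where "\<alpha> = 2 * a / b" and "\<beta> = (1 + a\<^sup>2 - b\<^sup>2) / b\<^sup>2"
    \<comment> \<open>Writing \<open>X = a + b x\<close> expresses \<open>(1 + X\<^sup>2) / Q\<close> through the two elements above.\<close>
    have "W = Q + [:\<alpha>:] * ([:b:] * [:- a, 1:]) + [:\<beta>:] * ([:b:] * [:b:])"
      using b by (simp add: W_def Q_def \<alpha>_def \<beta>_def power2_eq_square field_simps)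
    from arg_cong[OF this, of "\<lambda>f. to_fract f / to_fract Q"]
    have "Fract W Q = 1 + to_fract [:\<alpha>:] * Fract ([:b:] * [:- a, 1:]) Q
        + to_fract [:\<beta>:] * Fract ([:b:] * [:b:]) Q"
      using Q0 by (simp only: Fract_conv_to_fract add_divide_distrib to_fract_add to_fract_mult)
        simp
    also have "\<dots> \<in> dress"
      unfolding r1[symmetric] r2[symmetric]
      by (intro dress_add dress.mult dress.one dress_const dress.gen dress_x_over_one_plus_square)
    finally have "Fract W Q * Fract (W ^ n) h \<in> dress" using n(2) by (rule dress.mult)
    then have "Fract (W ^ Suc n) g \<in> dress" by (simp add: gh Q_def)
    then show ?thesis using deg n(1) by (intro exI[of _ "Suc n"]) simp
  qed
qed

text \<open>
  Elements of the ring have no pole at infinity. For a generator \<open>b\<^sup>2 / (a\<^sup>2 + b\<^sup>2)\<close> this is the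
  absence of cancellation in a sum of squares.
\<close>
lemma dress_degree_le:
  assumes "p \<in> dress" "p = Fract f g" "g \<noteq> 0"
  shows "degree f \<le> degree g"
proof -
  have "\<exists>a b. p = Fract a b \<and> b \<noteq> 0 \<and> degree a \<le> degree b"
    using assms(1)
  proof induction
    case (gen x)
    obtain a b where x: "x = Fract a b" "b \<noteq> 0" by (cases x) auto
    have deg: "degree (b\<^sup>2 + a\<^sup>2) = max (degree (b\<^sup>2)) (degree (a\<^sup>2))"
      by (rule degree_add_nonneg) simp_all
    have "1 + x ^ 2 = Fract (b\<^sup>2 + a\<^sup>2) (b\<^sup>2)"
      using x by (simp add: Fract_conv_to_fract power2_eq_square field_simps)
    then have "1 / (1 + x ^ 2) = Fract (b\<^sup>2) (b\<^sup>2 + a\<^sup>2)" "b\<^sup>2 + a\<^sup>2 \<noteq> 0"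
      using one_plus_square_nonzero[of x]
      by (auto simp: Fract_conv_to_fract)
    then show ?case using deg
      by (intro exI[of _ "b\<^sup>2"] exI[of _ "b\<^sup>2 + a\<^sup>2"]) simp
  next
    case one
    show ?case by (intro exI[of _ 1]) (simp add: One_fract_def)
  next
    case (diff p q)
    then obtain a b c d where p: "p = Fract a b" "b \<noteq> 0" "degree a \<le> degree b"
      and q: "q = Fract c d" "d \<noteq> 0" "degree c \<le> degree d" by blast
    have "degree (a * d) \<le> degree b + degree d" "degree (c * b) \<le> degree b + degree d"
      using p(3) q(3)
      by (auto intro: order_trans[OF degree_mult_le] add_mono simp: add.commute[of "degree c"])
    then have "degree (a * d - c * b) \<le> degree (b * d)"
      unfolding degree_mult_eq[OF p(2) q(2)] by (rule degree_diff_le)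
    moreover have "p - q = Fract (a * d - c * b) (b * d)"
      unfolding p(1) q(1) using p(2) q(2) by (rule diff_fract)
    moreover have "b * d \<noteq> 0" using p(2) q(2) by simp
    ultimately show ?case by blast
  next
    case (mult p q)
    then obtain a b c d where p: "p = Fract a b" "b \<noteq> 0" "degree a \<le> degree b"
      and q: "q = Fract c d" "d \<noteq> 0" "degree c \<le> degree d" by blast
    have "degree (a * c) \<le> degree (b * d)"
      using p(2,3) q(2,3) degree_mult_le[of a c] by (simp add: degree_mult_eq)
    moreover have "p * q = Fract (a * c) (b * d)" unfolding p(1) q(1) by (rule mult_fract)
    moreover have "b * d \<noteq> 0" using p(2) q(2) by simp
    ultimately show ?case by blast
  qed
  then obtain a b where ab: "Fract f g = Fract a b" "b \<noteq> 0" "degree a \<le> degree b"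
    unfolding assms(2) by blast
  then have eq: "f * b = a * g" using eq_fract(1)[OF assms(3) ab(2)] by blast
  show ?thesis
  proof (cases "f = 0")
    case False
    then have "a \<noteq> 0" using eq ab(2) by auto
    have "degree f + degree b = degree a + degree g"
      using arg_cong[OF eq, of degree]
      unfolding degree_mult_eq[OF False ab(2)] degree_mult_eq[OF \<open>a \<noteq> 0\<close> assms(3)] .
    then show ?thesis using ab(3) by simp
  qed simp
qed

lemma Fract_in_dress_iff:
  assumes "g \<in> Gam"
  shows "Fract f g \<in> dress \<longleftrightarrow> degree f \<le> degree g"
proof
  assume "Fract f g \<in> dress"
  then show "degree f \<le> degree g"
    by (rule dress_degree_le[OF _ refl Gam_nonzero[OF assms]])
next
  assume le: "degree f \<le> degree g"
  obtain n where n: "degree g = 2 * n" "Fract (W ^ n) g \<in> dress"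
    using W_power_over_Gam[OF assms] by blast
  have "Fract f (W ^ n) * Fract (W ^ n) g \<in> dress"
    using dress_over_W_power[of f n] le n by (intro dress.mult) simp_all
  moreover have "Fract f (W ^ n) * Fract (W ^ n) g = Fract f g"
    using Gam_nonzero[OF W_power_Gam, of n] by (simp add: Fract_conv_to_fract)
  ultimately show "Fract f g \<in> dress" by simp
qed


section \<open>Rows and products of idempotent matrices\<close>

definition mat2 :: "ratfun \<Rightarrow> ratfun \<Rightarrow> ratfun \<Rightarrow> ratfun \<Rightarrow> ratfun ^ 2 ^ 2" where
  "mat2 a b c d = vector [vector [a, b], vector [c, d]]"

lemma mat2_nth [simp]:
  "mat2 a b c d $ 1 $ 1 = a" "mat2 a b c d $ 1 $ 2 = b"
  "mat2 a b c d $ 2 $ 1 = c" "mat2 a b c d $ 2 $ 2 = d"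
  by (simp_all add: mat2_def)

lemma mat2_mult:
  "mat2 a b c d ** mat2 e f g h =
     mat2 (a * e + b * g) (a * f + b * h) (c * e + d * g) (c * f + d * h)"
  unfolding vec_eq_iff forall_2 by (simp add: matrix_matrix_mult_def sum_2)

lemma mat2_one: "mat 1 = mat2 1 0 0 1"
  unfolding vec_eq_iff forall_2 by (simp add: mat_def)

lemma mat2_in_dress_matrices:
  "mat2 a b c d \<in> dress_matrices \<longleftrightarrow> a \<in> dress \<and> b \<in> dress \<and> c \<in> dress \<and> d \<in> dress"
  unfolding dress_matrices_def mem_Collect_eq forall_2 by simp

lemma dress_matrices_mult:
  "A \<in> dress_matrices \<Longrightarrow> B \<in> dress_matrices \<Longrightarrow> A ** B \<in> dress_matrices"
  by (simp add: dress_matrices_def matrix_matrix_mult_def sum_2 dress_add dress.mult)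

lemma product_of_idempotents_idempotent:
  "T \<in> dress_matrices \<Longrightarrow> T ** T = T \<Longrightarrow> product_of_idempotents T"
  unfolding product_of_idempotents_def idempotent_matrix_def
  by (intro exI[of _ "[T]"]) simp

lemma product_of_idempotents_mult:
  assumes "product_of_idempotents A" "product_of_idempotents B"
  shows "product_of_idempotents (A ** B)"
proof -
  obtain Ss Ts where S: "Ss \<noteq> []" "\<forall>T\<in>set Ss. T \<in> dress_matrices \<and> idempotent_matrix T"
      "A = foldr (**) Ss (mat 1)"
    and T: "\<forall>T\<in>set Ts. T \<in> dress_matrices \<and> idempotent_matrix T" "B = foldr (**) Ts (mat 1)"
    using assms unfolding product_of_idempotents_def by blast
  have fold: "foldr (**) Ss M = foldr (**) Ss (mat 1) ** M" for M :: "ratfun ^ 2 ^ 2"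
    by (induction Ss) (simp_all add: matrix_mul_assoc)
  have "A ** B = foldr (**) (Ss @ Ts) (mat 1)"
    unfolding S(3) T(2) foldr_append comp_apply by (rule fold[symmetric])
  then show ?thesis using S T unfolding product_of_idempotents_def
    by (intro exI[of _ "Ss @ Ts"]) auto
qed

text \<open>
  Conjugation is multiplicative and preserves idempotents.
\<close>
lemma product_of_idempotents_conj:
  assumes A: "product_of_idempotents A"
    and GH: "G \<in> dress_matrices" "H \<in> dress_matrices" "G ** H = mat 1" "H ** G = mat 1"
  shows "product_of_idempotents (H ** A ** G)"
proof -
  obtain Ts where T: "Ts \<noteq> []" "\<forall>T\<in>set Ts. T \<in> dress_matrices \<and> idempotent_matrix T"
    "A = foldr (**) Ts (mat 1)"
    using A unfolding product_of_idempotents_def by blast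
  define c where "c = (\<lambda>T. H ** T ** G)"
  have c_mult: "c S ** c T = c (S ** T)" for S T
  proof -
    have "c S ** c T = H ** S ** (G ** H) ** T ** G" by (simp add: c_def matrix_mul_assoc)
    then show ?thesis by (simp add: GH c_def matrix_mul_assoc)
  qed
  have "c (foldr (**) Ts (mat 1)) = foldr (**) (map c Ts) (mat 1)"
    by (induction Ts) (simp_all add: c_def GH flip: c_mult[unfolded c_def])
  moreover have "c T \<in> dress_matrices \<and> idempotent_matrix (c T)" if "T \<in> set Ts" for T
    using T(2) that GH by (simp add: c_mult idempotent_matrix_def) (simp add: c_def dress_matrices_mult)
  moreover have "H ** A ** G = c (foldr (**) Ts (mat 1))" by (simp add: c_def T(3))
  ultimately show ?thesis using T(1) unfolding product_of_idempotents_def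
    by (intro exI[of _ "map c Ts"]) auto
qed

definition idempotent_row :: "ratfun \<Rightarrow> ratfun \<Rightarrow> bool" where
  "idempotent_row a b \<longleftrightarrow> product_of_idempotents (mat2 a b 0 0)"

lemma idempotent_row_one: "b \<in> dress \<Longrightarrow> idempotent_row 1 b"
  unfolding idempotent_row_def
  by (rule product_of_idempotents_idempotent)
     (simp_all add: mat2_in_dress_matrices mat2_mult dress.one dress_zero)

text \<open>
  The diagonal matrix with entries \<open>c\<close> and \<open>0\<close> is itself a product of four idempotents.
\<close>
lemma idempotent_row_scale:
  assumes "idempotent_row a b" "c \<in> dress"
  shows "idempotent_row (c * a) (c * b)"
proof -
  have idem: "product_of_idempotents (mat2 1 c 0 0)" "product_of_idempotents (mat2 0 0 1 1)"
    "product_of_idempotents (mat2 1 0 0 0)" "product_of_idempotents (mat2 0 0 0 1)"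
    by (rule product_of_idempotents_idempotent;
        simp add: mat2_in_dress_matrices mat2_mult dress.one dress_zero assms)+
  have "mat2 (c * a) (c * b) 0 0 =
      mat2 1 c 0 0 ** mat2 0 0 0 1 ** mat2 0 0 1 1 ** mat2 1 0 0 0 ** mat2 a b 0 0"
    by (simp add: mat2_mult)
  then show ?thesis
    using assms(1) idem unfolding idempotent_row_def
    by (simp only: product_of_idempotents_mult)
qed

text \<open>
  For the elementary upper triangular \<open>G\<close>, left multiplication by the inverse of \<open>G\<close> fixes every
  matrix with zero second row, so the column operation coincides with conjugation by \<open>G\<close>.
\<close>
lemma idempotent_row_add_right:
  assumes "idempotent_row a b" "c \<in> dress"
  shows "idempotent_row a (b + c * a)"
proof -
  have "product_of_idempotents (mat2 1 (- c) 0 1 ** mat2 a b 0 0 ** mat2 1 c 0 1)"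
    using assms unfolding idempotent_row_def
    by (intro product_of_idempotents_conj)
       (simp_all add: mat2_in_dress_matrices mat2_mult mat2_one dress.one dress_zero dress_uminus)
  then show ?thesis by (simp add: idempotent_row_def mat2_mult algebra_simps)
qed

text \<open>
  Conjugation by the permutation matrix moves the row to the second position; left multiplication
  by the idempotent with rows \<open>(1, 1)\<close> and \<open>(0, 0)\<close> brings it back.
\<close>
lemma idempotent_row_swap:
  assumes "idempotent_row a b"
  shows "idempotent_row b a"
proof -
  have "product_of_idempotents (mat2 0 1 1 0 ** mat2 a b 0 0 ** mat2 0 1 1 0)"
    using assms unfolding idempotent_row_def
    by (intro product_of_idempotents_conj)
       (simp_all add: mat2_in_dress_matrices mat2_mult mat2_one dress.one dress_zero)
  moreover have "product_of_idempotents (mat2 1 1 0 0)"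
    using idempotent_row_one[OF dress.one] by (simp add: idempotent_row_def)
  ultimately have "product_of_idempotents
      (mat2 1 1 0 0 ** (mat2 0 1 1 0 ** mat2 a b 0 0 ** mat2 0 1 1 0))"
    by (rule product_of_idempotents_mult[rotated])
  then show ?thesis by (simp add: idempotent_row_def mat2_mult)
qed

lemma idempotent_row_add_left:
  assumes "idempotent_row a b" "c \<in> dress"
  shows "idempotent_row (a + c * b) b"
  by (rule idempotent_row_swap[OF idempotent_row_add_right[OF idempotent_row_swap]]) (fact assms)+

text \<open>
  Conjugation by a diagonal matrix also divides the whole row by \<open>u\<close>, which scaling undoes.
\<close>
lemma idempotent_row_unit_left:
  assumes "idempotent_row a b" "u \<in> dress" "v \<in> dress" "u * v = 1"
  shows "idempotent_row (u * a) b"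
proof -
  have "product_of_idempotents (mat2 v 0 0 1 ** mat2 a b 0 0 ** mat2 u 0 0 1)"
    using assms unfolding idempotent_row_def
    by (intro product_of_idempotents_conj)
       (simp_all add: mat2_in_dress_matrices mat2_mult mat2_one dress.one dress_zero mult.commute)
  then have "idempotent_row (v * (a * u)) (v * b)"
    by (simp add: idempotent_row_def mat2_mult mult.assoc)
  then have "idempotent_row (u * (v * (a * u))) (u * (v * b))"
    using assms(2) by (rule idempotent_row_scale)
  then have "idempotent_row ((u * v) * (u * a)) ((u * v) * b)"
    by (simp only: ac_simps)
  then show ?thesis unfolding assms(4) by simp
qed

lemma idempotent_row_unit:
  assumes "u \<in> dress" "v \<in> dress" "u * v = 1" "b \<in> dress"
  shows "idempotent_row u b"
  using idempotent_row_unit_left[OF idempotent_row_one[OF assms(4)] assms(1-3)] by simp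

text \<open>
  The row is \<open>(1, 0)\<close> times the projection matrix with entries \<open>1\<close>, \<open>X\<close>, \<open>X\<close>, \<open>X\<^sup>2\<close> divided by
  \<open>1 + X\<^sup>2\<close>. Its entries generate the ideal of functions vanishing at infinity, which is not
  principal; so no column operations can reduce it to a row with a zero entry.
\<close>
lemma idempotent_row_circle:
  "idempotent_row (Fract 1 W) (Fract [:0, 1:] W)"
proof -
  define X where "X = to_fract [:0, 1 :: real:]"
  define w where "w = 1 / to_fract W"
  have X: "w * (1 + X ^ 2) = 1"
    using one_plus_square_nonzero[of X] by (simp add: w_def X_def to_fract_W)
  have "1 - w \<in> dress" "w \<in> dress" "X * w \<in> dress"
    using dress.gen[of X] dress_x_over_one_plus_square[of X]
    by (auto intro: dress.diff dress.one simp: w_def X_def to_fract_W)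
  moreover have "w * w + (X * w) * (X * w) = w"
  proof -
    have "w * w + (X * w) * (X * w) = w * (w * (1 + X ^ 2))"
      by (simp add: power2_eq_square algebra_simps)
    then show ?thesis by (simp add: X)
  qed
  ultimately have "product_of_idempotents (mat2 w (X * w) (X * w) (1 - w))"
    by (intro product_of_idempotents_idempotent)
       (simp_all add: mat2_in_dress_matrices mat2_mult algebra_simps)
  moreover have "product_of_idempotents (mat2 1 0 0 0)"
    using idempotent_row_one[OF dress_zero] by (simp add: idempotent_row_def)
  ultimately have "product_of_idempotents (mat2 1 0 0 0 ** mat2 w (X * w) (X * w) (1 - w))"
    by (rule product_of_idempotents_mult[rotated])
  then show ?thesis
    by (simp add: mat2_mult idempotent_row_def Fract_conv_to_fract w_def X_def)
qed


section \<open>Weakly comaximal rows with a nonnegative entry\<close>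

text \<open>
  After scaling, \<open>p = x / W ^ M\<close> and \<open>q = y / W ^ M\<close> where \<open>2 * M\<close> is the maximal degree \<open>N\<close> of the
  numerators, rounded up to an even number. The parity of \<open>N\<close> tells whether the common order of
  vanishing at infinity is \<open>0\<close> or \<open>1\<close>, and the column operation adding \<open>q\<close> times the second entry
  to the first replaces \<open>p\<close> by \<open>p + q\<^sup>2\<close>, which is positive on the real line.
\<close>
lemma idempotent_row_nonneg_numerator:
  fixes x y g :: "real poly"
  assumes g: "g \<in> Gam" and deg: "degree x \<le> degree g" "degree y \<le> degree g"
    and comax: "\<And>r. \<not> (poly x r = 0 \<and> poly y r = 0)"
    and nonneg: "\<And>r. poly x r \<ge> 0"
  shows "idempotent_row (Fract x g) (Fract y g)"
proof -
  define N where "N = max (degree x) (degree y)"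
  define M where "M = (N + 1) div 2"
  obtain n where n: "degree g = 2 * n" using W_power_over_Gam[OF g] by blast
  have N: "N \<le> 2 * M" "2 * M \<le> degree g"
    using deg n by (auto simp: N_def M_def)
  define p q where "p = Fract x (W ^ M)" and "q = Fract y (W ^ M)"
  have W0: "to_fract W \<noteq> 0" by simp
  have q: "q \<in> dress"
    using N by (simp add: q_def N_def Fract_in_dress_iff W_power_Gam degree_W_power)
  have reduce: "idempotent_row (Fract x g) (Fract y g)" if "idempotent_row p q"
  proof -
    have "Fract (W ^ M) g \<in> dress"
      using N g by (simp add: Fract_in_dress_iff degree_W_power)
    from idempotent_row_scale[OF that this] show ?thesis
      using W0 by (simp add: p_def q_def Fract_conv_to_fract)
  qed
  \<comment> \<open>The numerator of \<open>p + q\<^sup>2\<close>. It vanishes only at common real roots of \<open>x\<close> and \<open>y\<close>,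
    and the degree of this sum of nonnegative polynomials is known exactly.\<close>
  define s where "s = x * W ^ M + y * y"
  have pq: "p + q * q = Fract s (W ^ (2 * M))"
    using W0 by (simp add: p_def q_def s_def Fract_conv_to_fract mult_2 power_add add_divide_distrib)
  have "poly s r > 0" for r
  proof (cases "poly x r = 0")
    case True
    then show ?thesis using comax[of r] by (auto simp: s_def simp flip: power2_eq_square)
  next
    case False
    then have "poly x r * poly W r ^ M > 0"
      using nonneg[of r] W_pos[of r] by (intro mult_pos_pos zero_less_power) auto
    then show ?thesis by (auto simp: s_def intro: add_pos_nonneg)
  qed
  then have s: "s \<in> Gam" by (auto simp: Gam_def less_le)
  have "degree s = max (degree (x * W ^ M)) (degree (y * y))"
    unfolding s_def
    by (intro degree_add_nonneg)
       (simp_all add: nonneg W_pos[THEN less_imp_le])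
  moreover have "degree (y * y) = 2 * degree y"
    by (cases "y = 0") (simp_all add: degree_mult_eq)
  ultimately have degs:
    "degree s = max (if x = 0 then 0 else degree x + 2 * M) (2 * degree y)"
    by (simp add: degree_mult_eq degree_W_power)
  show ?thesis
  proof (cases "even N")
    case True
    then have M: "N = 2 * M" by (auto simp: M_def)
    have "degree s = 2 * N"
    proof (cases "x = 0 \<or> degree x < N")
      case True
      then have "degree y = N" by (auto simp: N_def)
      then show ?thesis using True M degs by auto
    next
      case False
      then have "degree x = N" "degree y \<le> N" by (auto simp: N_def)
      then show ?thesis using False M degs by auto
    qed
    then have u: "Fract s (W ^ (2 * M)) \<in> dress" "Fract (W ^ (2 * M)) s \<in> dress"
      using s by (simp_all add: Fract_in_dress_iff W_power_Gam degree_W_power M)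
    have "idempotent_row (p + q * q) q"
      unfolding pq using u(1,2) _ q
      by (rule idempotent_row_unit) (use Gam_nonzero[OF s] in \<open>simp add: Fract_conv_to_fract\<close>)
    from idempotent_row_add_left[OF this dress_uminus[OF q]] have "idempotent_row p q" by simp
    then show ?thesis by (rule reduce)
  next
    case False
    then have M: "N + 1 = 2 * M" by (auto simp: M_def)
    \<comment> \<open>The maximum \<open>N\<close> is odd, so it is attained by \<open>y\<close> alone.\<close>
    have x: "even (degree x)" using nonneg by (rule even_degree_nonneg)
    then have y: "degree y = N" "degree x + 1 \<le> N"
      using False by (auto simp: N_def max_def Suc_le_eq split: if_splits
          intro: le_neq_implies_less)
    have "degree s = 2 * N" using y degs M by auto
    then have degs': "degree s + 2 = 4 * M" using M by simp
    \<comment> \<open>Now \<open>p + q\<^sup>2\<close> vanishes to order exactly \<open>2\<close> at infinity: it is \<open>u / W\<close> with a unit \<open>u\<close>.\<close>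
    define u where "u = Fract (s * W) (W ^ (2 * M))"
    define v where "v = Fract (W ^ (2 * M)) (s * W)"
    have sW: "s * W \<in> Gam" "degree (s * W) = 4 * M"
      using s degs' W_power_Gam[of 1] Gam_nonzero[OF s]
      by (auto simp: Gam_def degree_mult_eq degree_W)
    then have uv: "u \<in> dress" "v \<in> dress"
      by (simp_all add: u_def v_def Fract_in_dress_iff W_power_Gam degree_W_power)
    have uv1: "u * v = 1"
      using Gam_nonzero[OF s] by (simp add: u_def v_def Fract_conv_to_fract)
    define c where "c = lead_coeff y"
    have "y \<noteq> 0" using y by auto
    then have c: "c \<noteq> 0" by (simp add: c_def)
    \<comment> \<open>The fraction \<open>z / W ^ M\<close> is \<open>X / W\<close>. Subtracting \<open>c * z\<close> from \<open>y\<close> cancels the leading term, so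
      \<open>q - c * X / W\<close> vanishes to order at least \<open>2\<close> at infinity and is a multiple of \<open>1 / W\<close>.\<close>
    define z where "z = [:0, 1:] * W ^ (M - 1)"
    have "degree z = N"
      using M by (simp add: z_def degree_mult_eq degree_W_power del: mult_pCons_left)
    have "lead_coeff z = 1"
      unfolding z_def lead_coeff_mult lead_coeff_power lead_coeff_W by simp
    define y' where "y' = y - smult c z"
    have "coeff y' N = 0"
      using \<open>degree z = N\<close> \<open>lead_coeff z = 1\<close> y(1) by (simp add: y'_def c_def)
    moreover have "degree y' \<le> N"
      unfolding y'_def using y(1) \<open>degree z = N\<close> by (intro degree_diff_le) auto
    ultimately have "degree y' \<le> 2 * (M - 1)"
      using M eq_zero_or_degree_less[of y' N] by auto
    then have t: "Fract y' (W ^ (M - 1)) \<in> dress"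
      by (simp add: Fract_in_dress_iff W_power_Gam degree_W_power)
    have q_eq: "q = to_fract [:c:] * Fract [:0, 1:] W + Fract y' (W ^ (M - 1)) * Fract 1 W"
    proof -
      have "y = y' + [:c:] * z" by (simp add: y'_def)
      from arg_cong[OF this, of to_fract]
      have y_eq: "to_fract y = to_fract y' + to_fract [:c:] * to_fract z"
        by (simp only: to_fract_add to_fract_mult)
      have WM: "to_fract W ^ M = to_fract W ^ (M - 1) * to_fract W"
        using M by (cases M) simp_all
      have z_eq: "to_fract z = to_fract [:0, 1:] * to_fract W ^ (M - 1)"
        unfolding z_def to_fract_mult to_fract_power ..
      show ?thesis
        unfolding q_def Fract_conv_to_fract to_fract_power y_eq z_eq WM add_divide_distrib
        using W0 by simp
    qed
    have inv: "to_fract [:c:] * to_fract [:1 / c:] = 1"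
      using c by (simp add: one_pCons flip: to_fract_mult to_fract_1)
    have "idempotent_row (to_fract [:c:] * Fract [:0, 1:] W) (Fract 1 W)"
      by (rule idempotent_row_unit_left[OF idempotent_row_swap[OF idempotent_row_circle]
            dress_const dress_const inv])
    then have "idempotent_row (Fract 1 W) (to_fract [:c:] * Fract [:0, 1:] W)"
      by (rule idempotent_row_swap)
    then have "idempotent_row (Fract 1 W) q"
      unfolding q_eq using t by (rule idempotent_row_add_right)
    from idempotent_row_unit_left[OF this uv uv1]
    have "idempotent_row (p + q * q) q"
      unfolding pq by (simp add: u_def Fract_conv_to_fract)
    from idempotent_row_add_left[OF this dress_uminus[OF q]] have "idempotent_row p q" by simp
    then show ?thesis by (rule reduce)
  qed
qed

theorem theorem3p3:
  fixes p q :: ratfun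
  assumes "p \<in> dress" and "q \<in> dress"
    and "weakly_comaximal p q"
    and "dress_nonneg p \<or> dress_nonneg q"
  shows "product_of_idempotents (vector [vector [p, q], vector [0, 0]])"
proof -
  obtain x y g where g: "g \<in> Gam_pos" and p: "p = Fract x g" and q: "q = Fract y g"
    and comax: "\<And>r. \<not> (poly x r = 0 \<and> poly y r = 0)"
    using assms(3) by (auto simp: weakly_comaximal_def weakly_comaximal_poly_iff)
  have g': "g \<in> Gam" using g Gam_pos_subset_Gam by blast
  have deg: "degree x \<le> degree g" "degree y \<le> degree g"
    using assms(1,2) g' by (simp_all add: p q Fract_in_dress_iff)
  have sign: "poly f r \<ge> 0" if "dress_nonneg (Fract f g)" for f r
  proof -
    have "poly g r > 0" using g by (simp add: Gam_pos_def)
    moreover from this have "poly f r / poly g r \<ge> 0"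
      using that rat_eval_Fract[of g r f] by (metis dress_nonneg_def less_irrefl)
    ultimately show ?thesis by (simp add: zero_le_divide_iff)
  qed
  from assms(4) have "idempotent_row p q"
  proof
    assume "dress_nonneg p"
    then show ?thesis unfolding p q
      using g' deg comax sign by (intro idempotent_row_nonneg_numerator) auto
  next
    assume "dress_nonneg q"
    then have "idempotent_row q p" unfolding p q
      using g' deg comax sign by (intro idempotent_row_nonneg_numerator) auto
    then show ?thesis by (rule idempotent_row_swap)
  qed
  then show ?thesis by (simp add: idempotent_row_def mat2_def)
qed

end
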